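(* Let $k\in\mathbb{Z}$, let $n\ge 1$ be an integer, and let $\lambda\in\mathbb{C}$ be nonzero. Then $$\beta_{n,\lambda}^{(k)}=\frac{1}{n+1}\left\{\beta_{n,\lambda}^{(k-1)}-\sum_{m=1}^{n-1}\binom{n}{m-1}\beta_{m,\lambda}^{(k)}\left(\frac{1}{\lambda}\right)_{n-m+1}\lambda^{n-m+1}-\lambda\sum_{m=0}^{n-1}\binom{n}{m}\left(\frac{1}{\lambda}\right)_{n-m}\lambda^{n-m}\,m\,\beta_{m,\lambda}^{(k)}\right\}.$$
   Context: For $k\in\mathbb{Z}$, $\mathrm{Li}_k(u)=\sum_{n=1}^{\infty}\frac{u^n}{n^k}$. For nonzero $\lambda$, the fully degenerate poly-Bernoulli numbers $\beta_{n,\lambda}^{(k)}$ are defined by the generating function (identity of formal power series in $t$) $$\frac{\mathrm{Li}_{k}\left(1-(1+\lambda t)^{-1/\lambda}\right)}{1-(1+\lambda t)^{-1/\lambda}}=\sum_{n=0}^{\infty}\beta_{n,\lambda}^{(k)}\frac{t^{n}}{n!},$$ where $(1+\lambda t)^{a}=\sum_{j\ge0}(a)_j\lambda^j\frac{t^j}{j!}$ and $\mathrm{Li}_k(u)/u$ denotes the series $\sum_{m\ge 0}u^m/(m+1)^k$. Here $(a)_j=a(a-1)\cdots(a-j+1)$, $(a)_0=1$, is the falling factorial. Empty sums are zero. *)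

theory Defs
  imports Complex_Main "HOL-Computational_Algebra.Formal_Power_Series"
begin

definition falling_fact :: "complex \<Rightarrow> nat \<Rightarrow> complex" where
  "falling_fact a j = (\<Prod>i<j. a - of_nat i)"

(* The series (1 + l t)^a in the variable t. *)
definition degen_binomial :: "complex \<Rightarrow> complex \<Rightarrow> complex fps" where
  "degen_binomial l a = Abs_fps (\<lambda>j. falling_fact a j * l ^ j / fact j)"

definition polylog_fps :: "int \<Rightarrow> complex fps" where
  "polylog_fps k = Abs_fps (\<lambda>n. if n = 0 then 0 else 1 / of_nat n powi k)"

(* The series Li_k(u) / u in the variable u. *)
definition polylog_quot_fps :: "int \<Rightarrow> complex fps" where
  "polylog_quot_fps k = Abs_fps (\<lambda>m. 1 / of_nat (m + 1) powi k)"

lemma polylog_fps_eq: "polylog_fps k = fps_X * polylog_quot_fps k"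
  by (rule fps_ext) (auto simp: polylog_fps_def polylog_quot_fps_def)

(* The series 1 - (1 + l t)^(-1/l); its constant term is 0, so it may be
   substituted into any formal power series. *)
definition degen_arg :: "complex \<Rightarrow> complex fps" where
  "degen_arg l = 1 - degen_binomial l (- 1 / l)"

lemma degen_arg_nth_0: "fps_nth (degen_arg l) 0 = 0"
  by (simp add: degen_arg_def degen_binomial_def falling_fact_def)

definition fully_degen_poly_bernoulli_fps :: "int \<Rightarrow> complex \<Rightarrow> complex fps" where
  "fully_degen_poly_bernoulli_fps k l = polylog_quot_fps k oo degen_arg l"

lemma fully_degen_poly_bernoulli_fps_mult:
  "degen_arg l * fully_degen_poly_bernoulli_fps k l = polylog_fps k oo degen_arg l"
  by (simp add: fully_degen_poly_bernoulli_fps_def polylog_fps_eq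
      fps_compose_mult_distrib degen_arg_nth_0)

definition fully_degen_poly_bernoulli :: "int \<Rightarrow> complex \<Rightarrow> nat \<Rightarrow> complex" where
  "fully_degen_poly_bernoulli k l n = fact n * fps_nth (fully_degen_poly_bernoulli_fps k l) n"

lemma fully_degen_poly_bernoulli_egf:
  "fully_degen_poly_bernoulli_fps k l = Abs_fps (\<lambda>n. fully_degen_poly_bernoulli k l n / fact n)"
  by (rule fps_ext) (simp add: fully_degen_poly_bernoulli_def)

end

theory Submission
  imports Defs
begin

text \<open>
  Write \<open>u = 1 - E\<close> with \<open>E = (1 + l t) powr (-1/l)\<close>, and \<open>Q\<^sub>k(u) = Li\<^sub>k(u) / u\<close>. Differentiating
  \<open>u Q\<^sub>k\<close> gives \<open>Q\<^sub>k\<^sub>-\<^sub>1 = Q\<^sub>k + u Q\<^sub>k'\<close>. Substituting \<open>u\<close> and using \<open>(1 + l t) u' = E\<close> and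
  \<open>F E = 1\<close> for \<open>F = (1 + l t) powr (1/l)\<close>, the generating functions satisfy
  \<open>B\<^sub>k\<^sub>-\<^sub>1 = B\<^sub>k + (F - 1) (1 + l t) B\<^sub>k'\<close>. The recurrence is the comparison of the coefficients
  of \<open>t ^ n / n!\<close>; the term with \<open>B\<^sub>k'\<close> contributes \<open>n \<beta>\<^sub>n\<close> to the factor \<open>n + 1\<close>.
\<close>

lemma falling_fact_Suc: "falling_fact a (Suc j) = falling_fact a j * (a - of_nat j)"
  by (simp add: falling_fact_def)

text \<open>Since \<open>falling_fact a j / fact j\<close> is \<open>a gchoose j\<close>, this is
  the usual binomial series with \<open>l t\<close> substituted. The exponent laws below are
  inherited through this form.\<close>

lemma degen_binomial_eq_compose: "degen_binomial l a = fps_binomial a oo (fps_const l * fps_X)"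
  by (rule fps_ext)
    (simp add: degen_binomial_def falling_fact_def fps_compose_linear fps_binomial_nth
      gbinomial_prod_rev atLeast0LessThan)

lemma degen_binomial_add_mult:
  "degen_binomial l (a + b) = degen_binomial l a * degen_binomial l b"
  by (simp add: degen_binomial_eq_compose fps_binomial_add_mult fps_compose_mult_distrib)

lemma degen_binomial_0: "degen_binomial l 0 = 1"
  by (simp add: degen_binomial_eq_compose)

lemma degen_binomial_nth_Suc:
  "of_nat (Suc n) * fps_nth (degen_binomial l a) (Suc n)
    = l * (a - of_nat n) * fps_nth (degen_binomial l a) n"
proof -
  have "(of_nat (Suc n) :: complex) \<noteq> 0"
    using of_nat_neq_0 by blast
  then show ?thesis
    by (simp add: degen_binomial_def falling_fact_Suc fact_Suc field_simps del: of_nat_Suc)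
qed

text \<open>The ratio of consecutive coefficients, read as a differential equation. Keeping the
  factor \<open>1 + l t\<close> on the left avoids inverting it.\<close>

lemma degen_binomial_deriv:
  "(1 + fps_const l * fps_X) * fps_deriv (degen_binomial l a)
    = fps_const (l * a) * degen_binomial l a"
proof (rule fps_ext)
  fix n
  show "fps_nth ((1 + fps_const l * fps_X) * fps_deriv (degen_binomial l a)) n
      = fps_nth (fps_const (l * a) * degen_binomial l a) n"
  proof (cases n)
    case 0
    then show ?thesis
      using degen_binomial_nth_Suc[of 0 l a] by (simp add: distrib_right mult.assoc)
  next
    case (Suc m)
    then show ?thesis
      using degen_binomial_nth_Suc[of n l a]
      by (simp add: distrib_right mult.assoc fps_deriv_nth algebra_simps)
  qed
qed

text \<open>The operator \<open>1 + u d/du\<close> multiplies the coefficient of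
  \<open>u ^ m\<close> by \<open>m + 1\<close>, which lowers the exponent \<open>k\<close> of
  \<open>m + 1\<close> by one.\<close>

lemma polylog_quot_fps_diff_1:
  "polylog_quot_fps (k - 1) = polylog_quot_fps k + fps_X * fps_deriv (polylog_quot_fps k)"
proof (rule fps_ext)
  fix n
  have nz: "(of_nat (Suc n) :: complex) \<noteq> 0"
    using of_nat_neq_0 by blast
  have "fps_nth (polylog_quot_fps (k - 1)) n = of_nat (Suc n) * fps_nth (polylog_quot_fps k) n"
    using nz by (simp add: polylog_quot_fps_def power_int_diff del: of_nat_Suc)
  also have "\<dots> = fps_nth (polylog_quot_fps k + fps_X * fps_deriv (polylog_quot_fps k)) n"
    by (cases n) (simp_all add: algebra_simps)
  finally show "fps_nth (polylog_quot_fps (k - 1)) n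
      = fps_nth (polylog_quot_fps k + fps_X * fps_deriv (polylog_quot_fps k)) n" .
qed

lemma fully_degen_poly_bernoulli_fps_diff_1:
  assumes "l \<noteq> 0"
  shows "fully_degen_poly_bernoulli_fps (k - 1) l = fully_degen_poly_bernoulli_fps k l
    + (degen_binomial l (1 / l) - 1) * ((1 + fps_const l * fps_X)
        * fps_deriv (fully_degen_poly_bernoulli_fps k l))"
proof -
  define u where "u = degen_arg l"
  define E where "E = degen_binomial l (- 1 / l)"
  define F where "F = degen_binomial l (1 / l)"
  define Q where "Q = fps_deriv (polylog_quot_fps k) oo u"
  have u0: "fps_nth u 0 = 0"
    by (simp add: u_def degen_arg_nth_0)
  have u_eq: "u = 1 - E"
    by (simp add: u_def E_def degen_arg_def)
  have FE: "F * E = 1"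
    using degen_binomial_add_mult[of l "1 / l" "- 1 / l"]
    by (simp add: E_def F_def degen_binomial_0)
  \<comment> \<open>The exponent \<open>- 1 / l\<close> turns the constant \<open>l * a\<close> into
    \<open>- 1\<close>; this needs \<open>l \<noteq> 0\<close>.\<close>
  have "(1 + fps_const l * fps_X) * fps_deriv E = - E"
    using degen_binomial_deriv[of l "- 1 / l"] assms
    by (simp add: E_def flip: fps_const_neg)
  then have deriv_u: "(1 + fps_const l * fps_X) * fps_deriv u = E"
    by (simp add: u_eq)
  have deriv_B: "fps_deriv (fully_degen_poly_bernoulli_fps k l) = Q * fps_deriv u"
    using u0 by (simp add: fully_degen_poly_bernoulli_fps_def Q_def fps_compose_deriv flip: u_def)
  have "(F - 1) * ((1 + fps_const l * fps_X) * fps_deriv (fully_degen_poly_bernoulli_fps k l))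
      = (F - 1) * (((1 + fps_const l * fps_X) * fps_deriv u) * Q)"
    by (simp only: deriv_B mult_ac)
  also have "\<dots> = (F * E - E) * Q"
    by (simp only: deriv_u) (simp add: algebra_simps)
  also have "\<dots> = u * Q"
    by (simp only: FE u_eq)
  finally have "(F - 1) * ((1 + fps_const l * fps_X)
      * fps_deriv (fully_degen_poly_bernoulli_fps k l)) = u * Q" .
  moreover have "fully_degen_poly_bernoulli_fps (k - 1) l
      = fully_degen_poly_bernoulli_fps k l + u * Q"
    using u0 by (simp add: fully_degen_poly_bernoulli_fps_def polylog_quot_fps_diff_1 Q_def
        fps_compose_add_distrib fps_compose_mult_distrib flip: u_def)
  ultimately show ?thesis
    by (simp add: F_def)
qed

text \<open>Binomial convolution of exponential generating functions. The term \<open>i = n\<close>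
  drops out because \<open>degen_binomial l a - 1\<close> has constant term 0.\<close>

lemma fact_mult_degen_binomial_minus_1_mult_nth:
  "fact n * fps_nth ((degen_binomial l a - 1) * A) n
    = (\<Sum>i<n. of_nat (n choose i) * (fact i * fps_nth A i)
        * falling_fact a (n - i) * l ^ (n - i))"
proof -
  have "fps_nth ((degen_binomial l a - 1) * A) n
      = (\<Sum>i=0..n. fps_nth A i * fps_nth (degen_binomial l a - 1) (n - i))"
    by (simp only: mult.commute[of _ A] fps_mult_nth)
  also have "\<dots> = (\<Sum>i<n. fps_nth A i * fps_nth (degen_binomial l a - 1) (n - i))"
    by (rule sum.mono_neutral_right) (auto simp: degen_binomial_def falling_fact_def)
  finally show ?thesis
    by (simp add: sum_distrib_left, intro sum.cong refl)
      (simp add: degen_binomial_def binomial_fact)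
qed

theorem theorem5:
  fixes k :: int and n :: nat and l :: complex
  assumes "n \<ge> 1" and "l \<noteq> 0"
  shows "fully_degen_poly_bernoulli k l n =
    1 / (of_nat n + 1) *
      (fully_degen_poly_bernoulli (k - 1) l n
       - (\<Sum>m = 1..n - 1. of_nat (n choose (m - 1)) * fully_degen_poly_bernoulli k l m
            * falling_fact (1 / l) (n - m + 1) * l ^ (n - m + 1))
       - l * (\<Sum>m = 0..n - 1. of_nat (n choose m) * falling_fact (1 / l) (n - m) * l ^ (n - m)
            * of_nat m * fully_degen_poly_bernoulli k l m))"
proof -
  let ?b = "fully_degen_poly_bernoulli k l"
  let ?B = "fully_degen_poly_bernoulli_fps k l"
  let ?f = "falling_fact (1 / l)"
  let ?F = "degen_binomial l (1 / l)"
  let ?S = "\<Sum>m = 1..n - 1. of_nat (n choose (m - 1)) * ?b m * ?f (n - m + 1) * l ^ (n - m + 1)"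
  let ?T = "\<Sum>m = 0..n - 1. of_nat (n choose m) * ?f (n - m) * l ^ (n - m) * of_nat m * ?b m"
  obtain p where n: "n = Suc p"
    using assms(1) by (cases n) auto
  have deriv_nth: "fact i * fps_nth (fps_deriv ?B) i = ?b (Suc i)" for i
    by (simp add: fully_degen_poly_bernoulli_def algebra_simps)
  \<comment> \<open>The Euler operator \<open>t d/dt\<close> is the source of the factor
    \<open>m\<close> in \<open>?T\<close>, whereas the plain derivative above shifts the index and
    leads to \<open>?S\<close>.\<close>
  have X_deriv_nth: "fact i * fps_nth (fps_X * fps_deriv ?B) i = of_nat i * ?b i" for i
    by (cases i) (simp_all add: fully_degen_poly_bernoulli_def algebra_simps)
  have "fact n * fps_nth ((?F - 1) * fps_deriv ?B) n
      = (\<Sum>i<n. of_nat (n choose i) * ?b (Suc i) * ?f (n - i) * l ^ (n - i))"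
    by (simp only: fact_mult_degen_binomial_minus_1_mult_nth deriv_nth)
  \<comment> \<open>The top term \<open>i = p\<close> contains \<open>?b n\<close> itself:
    \<open>n choose p\<close> is \<open>n\<close>, and \<open>?f 1 * l = 1\<close>.\<close>
  also have "\<dots> = (\<Sum>i<p. of_nat (n choose i) * ?b (Suc i) * ?f (n - i) * l ^ (n - i))
      + of_nat n * ?b n"
    using assms(2) by (simp add: n falling_fact_def)
  \<comment> \<open>Put \<open>m = i + 1\<close>, so that \<open>n - i = n - m + 1\<close>.\<close>
  also have "(\<Sum>i<p. of_nat (n choose i) * ?b (Suc i) * ?f (n - i) * l ^ (n - i)) = ?S"
    by (rule sum.reindex_bij_witness[of _ "\<lambda>m. m - 1" Suc]) (auto simp: n Suc_diff_le)
  finally have S: "fact n * fps_nth ((?F - 1) * fps_deriv ?B) n = ?S + of_nat n * ?b n" .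
  have "fact n * fps_nth ((?F - 1) * (fps_X * fps_deriv ?B)) n
      = (\<Sum>i<n. of_nat (n choose i) * (of_nat i * ?b i) * ?f (n - i) * l ^ (n - i))"
    by (simp only: fact_mult_degen_binomial_minus_1_mult_nth X_deriv_nth)
  also have "\<dots> = ?T"
    by (rule sum.cong) (auto simp: n)
  finally have T: "fact n * fps_nth ((?F - 1) * (fps_X * fps_deriv ?B)) n = ?T" .
  have "fully_degen_poly_bernoulli_fps (k - 1) l = ?B + (?F - 1) * fps_deriv ?B
      + fps_const l * ((?F - 1) * (fps_X * fps_deriv ?B))"
    by (simp only: fully_degen_poly_bernoulli_fps_diff_1[OF assms(2)]) (simp add: algebra_simps)
  then have "fully_degen_poly_bernoulli (k - 1) l n
      = fact n * fps_nth ?B n + fact n * fps_nth ((?F - 1) * fps_deriv ?B) n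
        + l * (fact n * fps_nth ((?F - 1) * (fps_X * fps_deriv ?B)) n)"
    by (simp only: fully_degen_poly_bernoulli_def fps_add_nth fps_mult_left_const_nth)
      (simp only: distrib_left mult_ac)
  \<comment> \<open>One copy of \<open>?b n\<close> comes from \<open>?B\<close>, the other
    \<open>n\<close> from the top term split off in \<open>S\<close>.\<close>
  also have "\<dots> = (of_nat n + 1) * ?b n + ?S + l * ?T"
    by (simp only: S T) (simp add: fully_degen_poly_bernoulli_def algebra_simps)
  finally have "fully_degen_poly_bernoulli (k - 1) l n - ?S - l * ?T = (of_nat n + 1) * ?b n"
    by simp
  moreover have "(of_nat n + 1 :: complex) \<noteq> 0"
    using of_nat_neq_0[of n] by (simp add: add.commute)
  ultimately show ?thesis
    by simp
qed

end
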